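(* Let $x$ be an allocation in a private bads instance $(N,B,c)$ and let $y$ be an allocation induced by $x$ in the induced public bads instance $\mathcal{R}(N,B,c)$. Then $x$ is a CEEI allocation for $(N,B,c)$ if and only if $y$ is a strictly positive proportionally fair allocation for $\mathcal{R}(N,B,c)$.
   Context: A private bads instance $(N,B,c)$ consists of agents $N=\{1,\dots,n\}$, a finite nonempty set $B$ of divisible bads, and costs $c_i(b)>0$ for all $i\in N$, $b\in B$. A (fractional) allocation is $x=(x_1,\dots,x_n)$ with $x_i:B\to[0,1]$ and $\sum_{i\in N}x_i(b)=1$ for all $b\in B$; agent $i$'s cost is $c_i(x)=\sum_{b\in B}c_i(b)x_i(b)$. CEEI: a pair $(x,p)$ of an allocation $x$ and a price vector $p\in\mathbb{R}^B_{>0}$ is a competitive equilibrium from equal incomes if (1) for all $i\in N$, $b\in B$: $x_i(b)>0$ implies $b\in\arg\min_{b'\in B}\frac{c_i(b')}{p(b')}$; and (2) $\sum_{b\in B}p(b)x_i(b)=1/n$ for all $i\in N$. $x$ is a CEEI allocation if $(x,p)$ is a CEEI for some $p$. Induced public bads instance $\mathcal{R}(N,B,c)$: the agents are $N$; the alternative set $A$ consists of all $n^{|B|}$ integral allocations $z$ (allocations with $z_i(b)\in\{0,1\}$ for all $i,b$); agent $i$'s cost for alternative $z$ is $c_i(z)=\sum_{b\in B}c_i(b)z_i(b)$. An allocation in $\mathcal{R}(N,B,c)$ is a lottery $y\in\Delta(A)$ (a probability vector on $A$), with $c_i(y)=\sum_{z\in A}y(z)c_i(z)$. A lottery $y\in\Delta(A)$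 is induced by $x$ if $x_i(b)=\sum_{z\in A}y(z)z_i(b)$ for all $i\in N$, $b\in B$. A lottery $y\in\Delta(A)$ is proportionally fair if $\frac1n\sum_{i\in N}\frac{c_i(w)}{c_i(y)}\ge1$ for all $w\in\Delta(A)$, with conventions $0/0=1$ and $\alpha/0=+\infty$ for $\alpha>0$; it is strictly positive if $c_i(y)>0$ for all $i\in N$. *)

theory Defs
  imports "HOL-Library.FuncSet" "HOL-Library.Extended_Real"
begin

text \<open>
  Functions whose domain is a set (allocations, lotteries, price vectors) are represented by
  extensional functions, so that distinct HOL functions are distinct mathematical objects. In
  particular the set of integral allocations below is finite, with \<open>n ^ card B\<close> elements.
\<close>

abbreviation agents :: "nat \<Rightarrow> nat set" where
  "agents n \<equiv> {1..n}"

definition private_bads_instance :: "nat \<Rightarrow> 'b set \<Rightarrow> (nat \<Rightarrow> 'b \<Rightarrow> real) \<Rightarrow> bool" where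
  "private_bads_instance n B c \<longleftrightarrow>
     finite B \<and> B \<noteq> {} \<and> (\<forall>i\<in>agents n. \<forall>b\<in>B. c i b > 0)"

definition allocations :: "nat \<Rightarrow> 'b set \<Rightarrow> (nat \<Rightarrow> 'b \<Rightarrow> real) set" where
  "allocations n B =
     {x \<in> agents n \<rightarrow>\<^sub>E (B \<rightarrow>\<^sub>E {0..1}). \<forall>b\<in>B. (\<Sum>i\<in>agents n. x i b) = 1}"

definition alloc_cost ::
  "'b set \<Rightarrow> (nat \<Rightarrow> 'b \<Rightarrow> real) \<Rightarrow> nat \<Rightarrow> (nat \<Rightarrow> 'b \<Rightarrow> real) \<Rightarrow> real" where
  "alloc_cost B c i x = (\<Sum>b\<in>B. c i b * x i b)"

definition is_CEEI ::
  "nat \<Rightarrow> 'b set \<Rightarrow> (nat \<Rightarrow> 'b \<Rightarrow> real) \<Rightarrow> (nat \<Rightarrow> 'b \<Rightarrow> real) \<Rightarrow> ('b \<Rightarrow> real) \<Rightarrow> bool" where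
  "is_CEEI n B c x p \<longleftrightarrow>
     x \<in> allocations n B \<and> p \<in> B \<rightarrow>\<^sub>E {0<..} \<and>
     (\<forall>i\<in>agents n. \<forall>b\<in>B. x i b > 0 \<longrightarrow> is_arg_min (\<lambda>b'. c i b' / p b') (\<lambda>b'. b' \<in> B) b) \<and>
     (\<forall>i\<in>agents n. (\<Sum>b\<in>B. p b * x i b) = 1 / real n)"

definition CEEI_allocation ::
  "nat \<Rightarrow> 'b set \<Rightarrow> (nat \<Rightarrow> 'b \<Rightarrow> real) \<Rightarrow> (nat \<Rightarrow> 'b \<Rightarrow> real) \<Rightarrow> bool" where
  "CEEI_allocation n B c x \<longleftrightarrow> (\<exists>p. is_CEEI n B c x p)"

text \<open>
  A public bads instance is given by a number \<open>n\<close> of agents, a set \<open>A\<close> of alternatives and a cost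
  function \<open>C\<close>, where \<open>C i a\<close> is the cost of alternative \<open>a\<close> for agent \<open>i\<close>.
\<close>

definition lotteries :: "'a set \<Rightarrow> ('a \<Rightarrow> real) set" where
  "lotteries A = {y \<in> A \<rightarrow>\<^sub>E {0..}. (\<Sum>a\<in>A. y a) = 1}"

definition lottery_cost :: "'a set \<Rightarrow> (nat \<Rightarrow> 'a \<Rightarrow> real) \<Rightarrow> nat \<Rightarrow> ('a \<Rightarrow> real) \<Rightarrow> real" where
  "lottery_cost A C i y = (\<Sum>a\<in>A. y a * C i a)"

text \<open>Division of nonnegative reals with \<open>0 / 0 = 1\<close> and \<open>\<alpha> / 0 = \<infinity>\<close> for \<open>\<alpha> > 0\<close>.\<close>

definition cost_ratio :: "real \<Rightarrow> real \<Rightarrow> ereal" where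
  "cost_ratio \<alpha> \<beta> = (if \<beta> = 0 then (if \<alpha> = 0 then 1 else \<infinity>) else ereal (\<alpha> / \<beta>))"

definition proportionally_fair ::
  "nat \<Rightarrow> 'a set \<Rightarrow> (nat \<Rightarrow> 'a \<Rightarrow> real) \<Rightarrow> ('a \<Rightarrow> real) \<Rightarrow> bool" where
  "proportionally_fair n A C y \<longleftrightarrow>
     y \<in> lotteries A \<and>
     (\<forall>w\<in>lotteries A.
        ereal (1 / real n) *
          (\<Sum>i\<in>agents n. cost_ratio (lottery_cost A C i w) (lottery_cost A C i y)) \<ge> 1)"

definition strictly_positive ::
  "nat \<Rightarrow> 'a set \<Rightarrow> (nat \<Rightarrow> 'a \<Rightarrow> real) \<Rightarrow> ('a \<Rightarrow> real) \<Rightarrow> bool" where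
  "strictly_positive n A C y \<longleftrightarrow> (\<forall>i\<in>agents n. lottery_cost A C i y > 0)"

text \<open>
  The public bads instance induced by \<open>n\<close>, \<open>B\<close>, \<open>c\<close> has the alternatives
  \<open>integral_allocations n B\<close> and the cost function \<open>alloc_cost B c\<close>.
\<close>

definition integral_allocations :: "nat \<Rightarrow> 'b set \<Rightarrow> (nat \<Rightarrow> 'b \<Rightarrow> real) set" where
  "integral_allocations n B =
     {z \<in> allocations n B. \<forall>i\<in>agents n. \<forall>b\<in>B. z i b \<in> {0, 1}}"

definition induced_by ::
  "nat \<Rightarrow> 'b set \<Rightarrow> (nat \<Rightarrow> 'b \<Rightarrow> real) \<Rightarrow> ((nat \<Rightarrow> 'b \<Rightarrow> real) \<Rightarrow> real) \<Rightarrow> bool" where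
  "induced_by n B x y \<longleftrightarrow>
     y \<in> lotteries (integral_allocations n B) \<and>
     (\<forall>i\<in>agents n. \<forall>b\<in>B. x i b = (\<Sum>z\<in>integral_allocations n B. y z * z i b))"

end

theory Submission
  imports Defs
begin

text \<open>
  Both conditions reduce to the values \<open>c\<^sub>i(x) = c\<^sub>i(y) > 0\<close>. In a CEEI each agent's minimal
  cost-price ratio is \<open>n c\<^sub>i(x)\<close>, so \<open>n p(b) \<le> c\<^sub>i(b) / c\<^sub>i(x)\<close> for all \<open>i\<close>; weighting by an
  integral allocation and using total price \<open>1\<close> gives proportional fairness. Conversely, take
  \<open>p(b) = min\<^sub>i c\<^sub>i(b) / (n c\<^sub>i(x))\<close>. Every agent spends at most \<open>1 / n\<close>, so the total price is
  at most \<open>1\<close>, while proportional fairness against the integral allocation that gives each \<open>b\<close> to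
  a minimising agent says that it is at least \<open>1\<close>. Hence all these inequalities are tight, which
  is the equilibrium condition.
\<close>

lemma finite_integral_allocations:
  assumes "finite B"
  shows "finite (integral_allocations n B)"
proof (rule finite_subset)
  show "integral_allocations n B \<subseteq> agents n \<rightarrow>\<^sub>E (B \<rightarrow>\<^sub>E {0, 1})"
    unfolding integral_allocations_def allocations_def by (fastforce simp: PiE_iff)
  show "finite (agents n \<rightarrow>\<^sub>E (B \<rightarrow>\<^sub>E {0, 1 :: real}))"
    using assms by (intro finite_PiE) auto
qed

lemma assignment_mem_integral_allocations:
  assumes "f \<in> B \<rightarrow> agents n"
  shows "(\<lambda>i\<in>agents n. \<lambda>b\<in>B. if f b = i then 1 else 0) \<in> integral_allocations n B"
  using assms unfolding integral_allocations_def allocations_def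
  by (auto simp: Pi_iff)

lemma point_mass_mem_lotteries:
  assumes "finite A" "a \<in> A"
  shows "(\<lambda>b\<in>A. if b = a then 1 else 0) \<in> lotteries A"
  using assms unfolding lotteries_def by auto

lemma lottery_cost_point_mass:
  assumes "finite A" "a \<in> A"
  shows "lottery_cost A C i (\<lambda>b\<in>A. if b = a then 1 else 0) = C i a"
proof -
  have "lottery_cost A C i (\<lambda>b\<in>A. if b = a then 1 else 0) = (\<Sum>b\<in>A. if b = a then C i b else 0)"
    unfolding lottery_cost_def by (rule sum.cong) auto
  then show ?thesis using assms by simp
qed

text \<open>Costs are additive over bads, so the expected cost of a lottery depends only on its
  marginals, and the marginals of \<open>y\<close> are \<open>x\<close>. This lets both sides of the
  theorem be compared through \<open>alloc_cost B c i x\<close>.\<close>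

lemma lottery_cost_induced:
  assumes "induced_by n B x y" "i \<in> agents n"
  shows "lottery_cost (integral_allocations n B) (alloc_cost B c) i y = alloc_cost B c i x"
proof -
  let ?A = "integral_allocations n B"
  have "lottery_cost ?A (alloc_cost B c) i y = (\<Sum>z\<in>?A. \<Sum>b\<in>B. c i b * (y z * z i b))"
    unfolding lottery_cost_def alloc_cost_def by (simp add: sum_distrib_left mult.left_commute)
  also have "\<dots> = (\<Sum>b\<in>B. c i b * (\<Sum>z\<in>?A. y z * z i b))"
    by (subst sum.swap) (simp add: sum_distrib_left)
  also have "\<dots> = alloc_cost B c i x"
    unfolding alloc_cost_def using assms by (auto simp: induced_by_def intro!: sum.cong)
  finally show ?thesis .
qed

text \<open>Strict positivity rules out the zero-denominator cases of \<open>cost_ratio\<close>, and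
  the sum of ratios is then linear in \<open>w\<close>. A linear bound holds on all lotteries as
  soon as it holds at the point masses, which leaves one real inequality per alternative.\<close>

lemma proportionally_fair_iff_pure:
  assumes "finite A" "n > 0" "y \<in> lotteries A" "strictly_positive n A C y"
  shows "proportionally_fair n A C y \<longleftrightarrow>
    (\<forall>a\<in>A. real n \<le> (\<Sum>i\<in>agents n. C i a / lottery_cost A C i y))"
proof -
  let ?S = "\<lambda>w. \<Sum>i\<in>agents n. lottery_cost A C i w / lottery_cost A C i y"
  have ratio: "ereal (1 / real n) *
        (\<Sum>i\<in>agents n. cost_ratio (lottery_cost A C i w) (lottery_cost A C i y)) \<ge> 1 \<longleftrightarrow>
      real n \<le> ?S w" for w
  proof -
    have "(\<Sum>i\<in>agents n. cost_ratio (lottery_cost A C i w) (lottery_cost A C i y)) =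
        (\<Sum>i\<in>agents n. ereal (lottery_cost A C i w / lottery_cost A C i y))"
      using assms(4) by (intro sum.cong refl) (metis cost_ratio_def less_irrefl strictly_positive_def)
    also have "\<dots> = ereal (?S w)" by simp
    finally show ?thesis
      using \<open>n > 0\<close> by (simp add: one_ereal_def field_simps del: sum_ereal)
  qed
  have "(\<forall>w\<in>lotteries A. real n \<le> ?S w) \<longleftrightarrow>
    (\<forall>a\<in>A. real n \<le> (\<Sum>i\<in>agents n. C i a / lottery_cost A C i y))"
  proof (intro iffI ballI)
    fix a assume *: "\<forall>w\<in>lotteries A. real n \<le> ?S w" and "a \<in> A"
    show "real n \<le> (\<Sum>i\<in>agents n. C i a / lottery_cost A C i y)"
      using bspec[OF * point_mass_mem_lotteries[OF \<open>finite A\<close> \<open>a \<in> A\<close>]]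
      by (simp only: lottery_cost_point_mass[OF \<open>finite A\<close> \<open>a \<in> A\<close>])
  next
    fix w
    assume *: "\<forall>a\<in>A. real n \<le> (\<Sum>i\<in>agents n. C i a / lottery_cost A C i y)"
      and w: "w \<in> lotteries A"
    have "real n = (\<Sum>a\<in>A. w a * real n)"
      using w by (simp add: lotteries_def flip: sum_distrib_right)
    also have "\<dots> \<le> (\<Sum>a\<in>A. w a * (\<Sum>i\<in>agents n. C i a / lottery_cost A C i y))"
      using * w by (intro sum_mono mult_left_mono) (auto simp: lotteries_def PiE_iff)
    also have "\<dots> = (\<Sum>i\<in>agents n. \<Sum>a\<in>A. w a * C i a / lottery_cost A C i y)"
      by (simp add: sum_distrib_left) (rule sum.swap)
    also have "\<dots> = ?S w"
      by (simp add: lottery_cost_def sum_divide_distrib)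
    finally show "real n \<le> ?S w" .
  qed
  then show ?thesis
    using assms(3) by (simp only: proportionally_fair_def ratio simp_thms)
qed

lemma allocation_nonneg:
  assumes "x \<in> allocations n B" "i \<in> agents n" "b \<in> B"
  shows "0 \<le> x i b"
proof -
  have "x i \<in> B \<rightarrow>\<^sub>E {0..1}" using assms(1,2) by (auto simp: allocations_def)
  then show ?thesis using assms(3) by (auto simp: PiE_iff)
qed

text \<open>Every bad is handed out completely, so the spendings of the agents add up to the total
  price.\<close>

lemma sum_allocation:
  assumes "x \<in> allocations n B"
  shows "(\<Sum>i\<in>agents n. \<Sum>b\<in>B. p b * x i b) = sum p B"
proof -
  have "(\<Sum>i\<in>agents n. \<Sum>b\<in>B. p b * x i b) = (\<Sum>b\<in>B. p b * (\<Sum>i\<in>agents n. x i b))"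
    by (subst sum.swap) (simp add: sum_distrib_left)
  also have "\<dots> = sum p B" using assms by (simp add: allocations_def)
  finally show ?thesis .
qed

text \<open>With \<open>m\<close> the minimal cost-price ratio of agent \<open>i\<close>, all
  purchases are made at ratio \<open>m\<close>, so the cost is \<open>m\<close> times the budget
  \<open>1 / n\<close>. Hence \<open>m\<close> is \<open>n\<close> times the cost, and the second
  claim is \<open>m \<le> c i b / p b\<close> rearranged.\<close>

lemma CEEI_cost:
  assumes inst: "private_bads_instance n B c" and ceei: "is_CEEI n B c x p" and i: "i \<in> agents n"
  shows "0 < alloc_cost B c i x"
    and "b \<in> B \<Longrightarrow> real n * p b \<le> c i b / alloc_cost B c i x"
proof -
  have fin: "finite B" and ne: "B \<noteq> {}" and cpos: "\<And>b. b \<in> B \<Longrightarrow> c i b > 0"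
    using inst i by (auto simp: private_bads_instance_def)
  have x: "x \<in> allocations n B" and ppos: "\<And>b. b \<in> B \<Longrightarrow> p b > 0"
    and opt: "\<And>b b'. b \<in> B \<Longrightarrow> x i b > 0 \<Longrightarrow> b' \<in> B \<Longrightarrow> c i b / p b \<le> c i b' / p b'"
    and spend: "(\<Sum>b\<in>B. p b * x i b) = 1 / real n"
    using ceei i by (auto simp: is_CEEI_def is_arg_min_def PiE_iff not_less)
  have n: "n > 0" using i by auto
  define m where "m = Min ((\<lambda>b. c i b / p b) ` B)"
  have m_le: "m \<le> c i b / p b" if "b \<in> B" for b
    using that fin by (auto simp: m_def)
  have "m \<in> (\<lambda>b. c i b / p b) ` B" unfolding m_def using fin ne by (intro Min_in) auto
  then obtain b0 where b0: "b0 \<in> B" "m = c i b0 / p b0" by auto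
  have mpos: "m > 0" using b0 cpos ppos by simp
  \<comment> \<open>On the support of \<open>x i\<close> the ratio equals \<open>m\<close>; off the
    support both sides vanish.\<close>
  have "c i b * x i b = m * (p b * x i b)" if "b \<in> B" for b
  proof (cases "x i b > 0")
    case True
    then have "c i b / p b = m" using opt[of b b0] b0 m_le[of b] that by simp
    then show ?thesis using ppos[OF that] by (auto simp: field_simps)
  next
    case False
    then have "x i b = 0" using allocation_nonneg[OF x i that] by simp
    then show ?thesis by simp
  qed
  then have "alloc_cost B c i x = (\<Sum>b\<in>B. m * (p b * x i b))"
    unfolding alloc_cost_def by (intro sum.cong refl)
  then have cost: "alloc_cost B c i x = m / real n"
    by (simp add: spend flip: sum_distrib_left)
  then show "0 < alloc_cost B c i x" using mpos n by simp
  show "real n * p b \<le> c i b / alloc_cost B c i x" if "b \<in> B"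
    using m_le[OF that] ppos[OF that] mpos n by (simp add: cost field_simps)
qed

text \<open>The \<open>n\<close> budgets of \<open>1 / n\<close> make the total price
  \<open>1\<close>, so at prices \<open>n * p b\<close> the bundles of \<open>z\<close> are worth
  \<open>n\<close> together. \<open>CEEI_cost\<close> bounds these prices by the normalized costs of
  whichever agent receives \<open>b\<close>.\<close>

lemma CEEI_imp_pure_fair:
  assumes inst: "private_bads_instance n B c" and ceei: "is_CEEI n B c x p"
    and n: "n > 0" and z: "z \<in> allocations n B"
  shows "real n \<le> (\<Sum>i\<in>agents n. alloc_cost B c i z / alloc_cost B c i x)"
proof -
  have x: "x \<in> allocations n B" using ceei by (simp add: is_CEEI_def)
  have "sum p B = (\<Sum>i\<in>agents n. 1 / real n)"
    unfolding sum_allocation[OF x, symmetric, of p] using ceei by (simp add: is_CEEI_def)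
  then have "real n = real n * sum p B" using n by simp
  also have "\<dots> = (\<Sum>i\<in>agents n. \<Sum>b\<in>B. real n * p b * z i b)"
    using sum_allocation[OF z, of "\<lambda>b. real n * p b"] by (simp add: sum_distrib_left)
  also have "\<dots> \<le> (\<Sum>i\<in>agents n. \<Sum>b\<in>B. c i b / alloc_cost B c i x * z i b)"
    using CEEI_cost(2)[OF inst ceei] allocation_nonneg[OF z]
    by (intro sum_mono mult_right_mono)
  also have "\<dots> = (\<Sum>i\<in>agents n. alloc_cost B c i z / alloc_cost B c i x)"
    by (simp add: alloc_cost_def[of B c _ z] sum_divide_distrib)
  finally show ?thesis .
qed

lemma pure_fair_imp_CEEI:
  assumes inst: "private_bads_instance n B c" and x: "x \<in> allocations n B" and n: "n > 0"
    and pos: "\<And>i. i \<in> agents n \<Longrightarrow> 0 < alloc_cost B c i x"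
    and fair: "\<And>z. z \<in> integral_allocations n B \<Longrightarrow>
      real n \<le> (\<Sum>i\<in>agents n. alloc_cost B c i z / alloc_cost B c i x)"
  shows "CEEI_allocation n B c x"
proof -
  have fin: "finite B" and cpos: "\<And>i b. i \<in> agents n \<Longrightarrow> b \<in> B \<Longrightarrow> c i b > 0"
    using inst by (auto simp: private_bads_instance_def)
  \<comment> \<open>\<open>q i b\<close> is the price of \<open>b\<close> at which the ratio of
    agent \<open>i\<close> equals \<open>n\<close> times the cost of \<open>x\<close>, the value
    that \<open>CEEI_cost\<close> shows to be the minimal ratio in any equilibrium.\<close>
  define q where "q i b = c i b / (real n * alloc_cost B c i x)" for i b
  have "\<exists>i\<in>agents n. \<forall>j\<in>agents n. q i b \<le> q j b" for b
  proof -
    have "finite (agents n)" "agents n \<noteq> {}" using n by auto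
    then obtain i where "is_arg_min (\<lambda>i. q i b) (\<lambda>i. i \<in> agents n) i"
      using ex_is_arg_min_if_finite by blast
    then show ?thesis unfolding is_arg_min_linorder by blast
  qed
  then obtain f where f: "\<And>b. f b \<in> agents n" and f_min: "\<And>b j. j \<in> agents n \<Longrightarrow> q (f b) b \<le> q j b"
    by metis
  define p where "p = (\<lambda>b\<in>B. q (f b) b)"
  have p_le: "p b \<le> q i b" if "i \<in> agents n" "b \<in> B" for i b
    using that f_min by (simp add: p_def)
  have ppos: "p b > 0" if "b \<in> B" for b
    using that pos[OF f] cpos[OF f] n by (simp add: p_def q_def)
  define z where "z = (\<lambda>i\<in>agents n. \<lambda>b\<in>B. if f b = i then 1 else 0 :: real)"
  have z: "z \<in> integral_allocations n B"
    unfolding z_def using f by (intro assignment_mem_integral_allocations) auto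
  then have za: "z \<in> allocations n B" by (simp add: integral_allocations_def)
  have "real n \<le> (\<Sum>i\<in>agents n. alloc_cost B c i z / alloc_cost B c i x)" by (rule fair[OF z])
  \<comment> \<open>Only terms with \<open>f b = i\<close> survive, and there
    \<open>p b = q i b\<close>, so the normalized cost of \<open>b\<close> is exactly
    \<open>n * p b\<close>.\<close>
  also have "\<dots> = (\<Sum>i\<in>agents n. \<Sum>b\<in>B. real n * p b * z i b)"
    unfolding alloc_cost_def[of B c _ z] sum_divide_distrib
    using n by (intro sum.cong) (auto simp: z_def p_def q_def)
  also have "\<dots> = real n * sum p B"
    using sum_allocation[OF za, of "\<lambda>b. real n * p b"] by (simp add: sum_distrib_left)
  finally have p_ge: "1 \<le> sum p B" using n by simp
  have tot: "(\<Sum>b\<in>B. q i b * x i b) = 1 / real n" if "i \<in> agents n" for i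
  proof -
    have "(\<Sum>b\<in>B. q i b * x i b) = alloc_cost B c i x / (real n * alloc_cost B c i x)"
      by (simp add: q_def alloc_cost_def[of B c i x] sum_divide_distrib)
    then show ?thesis using pos[OF that] by simp
  qed
  \<comment> \<open>At the personal prices \<open>q i\<close> agent \<open>i\<close> spends exactly
    \<open>1 / n\<close>; \<open>gap i b\<close> is the excess over the common price paid on
    \<open>b\<close>. The gaps are nonnegative with total \<open>1 - sum p B \<le> 0\<close>, so
    each of them vanishes.\<close>
  define gap where "gap i b = (q i b - p b) * x i b" for i b
  have gap_nonneg: "gap i b \<ge> 0" if "i \<in> agents n" "b \<in> B" for i b
    using p_le[OF that] allocation_nonneg[OF x that] by (simp add: gap_def)
  have gap_sum: "(\<Sum>b\<in>B. gap i b) = 1 / real n - (\<Sum>b\<in>B. p b * x i b)" if "i \<in> agents n" for i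
    by (simp add: gap_def left_diff_distrib sum_subtractf tot[OF that])
  have "(\<Sum>i\<in>agents n. \<Sum>b\<in>B. gap i b) = 1 - sum p B"
    using n by (simp add: gap_sum sum_subtractf sum_allocation[OF x] del: One_nat_def)
  then have "(\<Sum>i\<in>agents n. \<Sum>b\<in>B. gap i b) = 0"
    using p_ge gap_nonneg by (intro antisym sum_nonneg) simp_all
  then have gap_sum0: "(\<Sum>b\<in>B. gap i b) = 0" if "i \<in> agents n" for i
    using sum_nonneg_eq_0_iff[of "agents n" "\<lambda>i. \<Sum>b\<in>B. gap i b"] gap_nonneg that
    by (simp add: sum_nonneg)
  then have gap0: "gap i b = 0" if "i \<in> agents n" "b \<in> B" for i b
    using sum_nonneg_eq_0_iff[OF fin, of "gap i"] gap_nonneg that by simp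
  have "is_arg_min (\<lambda>b'. c i b' / p b') (\<lambda>b'. b' \<in> B) b"
    if i: "i \<in> agents n" and b: "b \<in> B" and xpos: "x i b > 0" for i b
  proof -
    \<comment> \<open>A positive share turns the vanishing gap into equality of prices, so the ratio
      at \<open>b\<close> is \<open>n\<close> times the cost of \<open>x\<close>;
      \<open>p \<le> q\<close> makes this value a lower bound for the ratio at every other
      bad.\<close>
    have "p b = q i b" using gap0[OF i b] xpos by (simp add: gap_def)
    then have "c i b / p b = real n * alloc_cost B c i x"
      using ppos[OF b] n cpos[OF i b] by (simp add: q_def)
    moreover have "real n * alloc_cost B c i x \<le> c i b' / p b'" if "b' \<in> B" for b'
      using p_le[OF i that] ppos[OF that] pos[OF i] n by (simp add: q_def field_simps)
    ultimately show ?thesis using b by (auto simp: is_arg_min_def not_less)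
  qed
  moreover have "(\<Sum>b\<in>B. p b * x i b) = 1 / real n" if "i \<in> agents n" for i
    using gap_sum[OF that] gap_sum0[OF that] by simp
  moreover have "p \<in> B \<rightarrow>\<^sub>E {0<..}"
    using ppos by (auto simp: p_def)
  ultimately show ?thesis using x by (auto simp: CEEI_allocation_def is_CEEI_def)
qed

theorem theorem4p11:
  fixes n :: nat and B :: "'b set" and c :: "nat \<Rightarrow> 'b \<Rightarrow> real"
    and x :: "nat \<Rightarrow> 'b \<Rightarrow> real" and y :: "(nat \<Rightarrow> 'b \<Rightarrow> real) \<Rightarrow> real"
  assumes "private_bads_instance n B c"
    and "x \<in> allocations n B"
    and "induced_by n B x y"
  shows "CEEI_allocation n B c x \<longleftrightarrow>
           strictly_positive n (integral_allocations n B) (alloc_cost B c) y \<and>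
           proportionally_fair n (integral_allocations n B) (alloc_cost B c) y"
proof -
  let ?A = "integral_allocations n B" and ?C = "alloc_cost B c"
  have fin: "finite B" and ne: "B \<noteq> {}" using assms(1) by (auto simp: private_bads_instance_def)
  \<comment> \<open>With no agents, the shares of any bad would form an empty sum, which is not
    \<open>1\<close>.\<close>
  have n: "n > 0" using assms(2) ne by (cases n) (auto simp: allocations_def)
  have y: "y \<in> lotteries ?A" using assms(3) by (simp add: induced_by_def)
  have sp: "strictly_positive n ?A ?C y \<longleftrightarrow> (\<forall>i\<in>agents n. 0 < ?C i x)"
    by (simp add: strictly_positive_def lottery_cost_induced[OF assms(3)])
  have pf: "proportionally_fair n ?A ?C y \<longleftrightarrow>
      (\<forall>z\<in>?A. real n \<le> (\<Sum>i\<in>agents n. ?C i z / ?C i x))" if "strictly_positive n ?A ?C y"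
    using proportionally_fair_iff_pure[OF finite_integral_allocations[OF fin] n y that]
    by (simp add: lottery_cost_induced[OF assms(3)])
  show ?thesis
  proof
    assume "CEEI_allocation n B c x"
    then obtain p where ceei: "is_CEEI n B c x p" by (auto simp: CEEI_allocation_def)
    have "strictly_positive n ?A ?C y"
      using CEEI_cost(1)[OF assms(1) ceei] sp by blast
    moreover have "\<forall>z\<in>?A. real n \<le> (\<Sum>i\<in>agents n. ?C i z / ?C i x)"
      using CEEI_imp_pure_fair[OF assms(1) ceei n] by (simp add: integral_allocations_def)
    ultimately show "strictly_positive n ?A ?C y \<and> proportionally_fair n ?A ?C y"
      using pf by blast
  next
    assume "strictly_positive n ?A ?C y \<and> proportionally_fair n ?A ?C y"
    then show "CEEI_allocation n B c x"
      using pf sp by (intro pure_fair_imp_CEEI[OF assms(1,2) n]) auto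
  qed
qed

end
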